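(* If $t\ge 3$ is odd, then $\operatorname{sat}_{K_r}(n,P_{t+1})=0$ for all $n\ge 3\cdot 2^{\frac{t+1}{2}-1}-2$ and all $r\ge 3$. If $t\ge 4$ is even, then $\operatorname{sat}_{K_r}(n,P_{t+1})=0$ for all $n\ge 2^{\frac{t}{2}+1}-2$ and all $r\ge 3$.
   Context: All graphs are finite and simple. $P_{t+1}$ is the path on $t+1$ vertices. A graph $G$ is $F$-saturated if it contains no copy of $F$ as a (not necessarily induced) subgraph, but adding any missing edge creates a copy of $F$. $\operatorname{sat}_H(n,F)$ denotes the minimum number of copies of $H$ (as a not necessarily induced subgraph) among all $F$-saturated graphs on $n$ vertices. *)

theory Defs
  imports Main "HOL-Library.Extended_Nat"
begin

type_synonym 'a graph = "'a set \<times> 'a set set"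

abbreviation verts :: "'a graph \<Rightarrow> 'a set" where "verts \<equiv> fst"

abbreviation edges :: "'a graph \<Rightarrow> 'a set set" where "edges \<equiv> snd"

definition simple_graph :: "'a graph \<Rightarrow> bool" where
  "simple_graph G \<longleftrightarrow> finite (verts G) \<and> (\<forall>e\<in>edges G. e \<subseteq> verts G \<and> card e = 2)"

definition subgraph :: "'a graph \<Rightarrow> 'a graph \<Rightarrow> bool" where
  "subgraph S G \<longleftrightarrow> simple_graph S \<and> verts S \<subseteq> verts G \<and> edges S \<subseteq> edges G"

definition isomorphic :: "'a graph \<Rightarrow> 'b graph \<Rightarrow> bool" where
  "isomorphic G H \<longleftrightarrow> (\<exists>f. bij_betw f (verts G) (verts H) \<and>
     (\<forall>u\<in>verts G. \<forall>v\<in>verts G. {u, v} \<in> edges G \<longleftrightarrow> {f u, f v} \<in> edges H))"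

definition copies :: "'b graph \<Rightarrow> 'a graph \<Rightarrow> 'a graph set" where
  "copies H G = {S. subgraph S G \<and> isomorphic S H}"

definition add_edge :: "'a \<Rightarrow> 'a \<Rightarrow> 'a graph \<Rightarrow> 'a graph" where
  "add_edge u v G = (verts G, insert {u, v} (edges G))"

definition saturated :: "'b graph \<Rightarrow> 'a graph \<Rightarrow> bool" where
  "saturated F G \<longleftrightarrow> simple_graph G \<and> copies F G = {} \<and>
     (\<forall>u\<in>verts G. \<forall>v\<in>verts G. u \<noteq> v \<and> {u, v} \<notin> edges G \<longrightarrow> copies F (add_edge u v G) \<noteq> {})"

text \<open>Every finite graph is isomorphic to one with vertices in \<^typ>\<open>nat\<close>, so it suffices to
  range over these. The infimum is taken in \<^typ>\<open>enat\<close>, where it is a minimum whenever an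
  \<open>F\<close>-saturated graph on \<open>n\<close> vertices exists and is \<open>\<infinity>\<close> (not \<open>0\<close>, as it would be in
  \<^typ>\<open>nat\<close>) otherwise.\<close>

definition sat_number :: "'b graph \<Rightarrow> nat \<Rightarrow> 'c graph \<Rightarrow> enat" where
  "sat_number H n F =
     (INF G \<in> {G :: nat graph. saturated F G \<and> card (verts G) = n}. enat (card (copies H G)))"

definition path_graph :: "nat \<Rightarrow> nat graph" where
  "path_graph k = ({..<k}, {{i, Suc i} |i. Suc i < k})"

definition complete_graph :: "nat \<Rightarrow> nat graph" where
  "complete_graph r = ({..<r}, {e. e \<subseteq> {..<r} \<and> card e = 2})"

lemma simple_graph_path_graph: "simple_graph (path_graph k)"
  by (auto simp: simple_graph_def path_graph_def)

lemma simple_graph_complete_graph: "simple_graph (complete_graph r)"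
  by (auto simp: simple_graph_def complete_graph_def)

end

theory Submission
  imports Defs "HOL-Library.Disjoint_Sets"
begin

text \<open>
  The saturated graph that witnesses the value 0 is a tree, so it has no triangle and hence no
  \<open>K\<^sub>r\<close> with \<open>r \<ge> 3\<close>. It consists of two rooted trees of heights \<open>a\<close> and \<open>b\<close> with
  \<open>b \<le> a \<le> b + 1\<close> and \<open>t = a + b + 2\<close>, whose roots are joined by an edge. In each of the two, all
  leaves lie at the same depth and every inner vertex has at least two children. For even \<open>t\<close> the
  heights agree; for odd \<open>t\<close> they differ by one, and the taller root is the centre of the tree.

  No path has more than \<open>t\<close> vertices: a path through the joining edge starts at a root on both sides
  of it and has at most \<open>(a + 1) + (b + 1)\<close> vertices, and a path inside one of the two trees has at
  most \<open>2 * a + 1 \<le> a + b + 2\<close> vertices (lemma \<open>path_in_join_le\<close>).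

  A new edge gives a path with \<open>t + 1\<close> vertices for two reasons, both of which rest on the branching.
  First, in a tree of height \<open>h\<close> a path with \<open>h + 1\<close> vertices starts at every vertex, and one with
  \<open>h + 2\<close> vertices unless the vertex is the root (\<open>full_tree_long_path_from\<close>). A new edge between
  the two trees links such paths, and one of its ends is not a root. Secondly, a new edge inside a
  tree of height \<open>h\<close> yields a path from the root with \<open>h + 2\<close> instead of \<open>h + 1\<close> vertices
  (\<open>full_tree_add_edge\<close>), which the joining edge extends by a descent in the other tree.

  The smallest such trees are binary and have \<open>(2 ^ (a + 1) - 1) + (2 ^ (b + 1) - 1)\<close> vertices, which
  is the stated bound on \<open>n\<close>. As an inner vertex may have more than two children, further leaves can be
  hung on a lowest inner vertex, and every larger number of vertices occurs as well.
\<close>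

section \<open>Paths as lists of vertices\<close>

definition path_in :: "'a graph \<Rightarrow> 'a list \<Rightarrow> bool" where
  "path_in G xs \<longleftrightarrow>
     distinct xs \<and> set xs \<subseteq> verts G \<and> successively (\<lambda>x y. {x, y} \<in> edges G) xs"

lemma path_in_rev: "path_in G (rev xs) \<longleftrightarrow> path_in G xs"
  by (simp add: path_in_def successively_rev insert_commute)

lemma path_in_mono:
  "path_in G xs \<Longrightarrow> verts G \<subseteq> verts H \<Longrightarrow> edges G \<subseteq> edges H \<Longrightarrow> path_in H xs"
  unfolding path_in_def by (meson successively_mono subset_trans subsetD)

lemma path_in_appendD:
  assumes "path_in G (xs @ ys)"
  shows "path_in G xs" "path_in G ys"
  using assms by (auto simp: path_in_def successively_append_iff)

lemma path_in_append:
  assumes "path_in G xs" "path_in H ys" "verts G \<inter> verts H = {}"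
    and "verts G \<union> verts H \<subseteq> verts K" "edges G \<union> edges H \<subseteq> edges K"
    and "{last xs, hd ys} \<in> edges K"
  shows "path_in K (xs @ ys)"
proof -
  have "path_in K xs" "path_in K ys"
    using assms by (auto intro: path_in_mono)
  then show ?thesis
    using assms by (auto simp: path_in_def successively_append_iff)
qed

lemma path_in_Cons:
  assumes "path_in G xs" "r \<notin> verts G" "r \<in> verts K"
    and "verts G \<subseteq> verts K" "edges G \<subseteq> edges K" "xs \<noteq> []" "{r, hd xs} \<in> edges K"
  shows "path_in K (r # xs)"
proof -
  have "path_in ({r}, {}) [r]" by (simp add: path_in_def)
  then show ?thesis
    using path_in_append[of "({r}, {})" "[r]" G xs K] assms by auto
qed

text \<open>For a path confined to \<open>H\<close> from an inner vertex on, this is applied to both directions away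
  from that vertex.\<close>

lemma path_in_confined_hd:
  assumes "path_in G xs" "xs \<noteq> []" "hd xs \<in> verts H"
    and "\<And>x y. x \<in> set xs \<Longrightarrow> y \<in> set xs \<Longrightarrow> x \<in> verts H \<Longrightarrow> {x, y} \<in> edges G \<Longrightarrow>
           y \<in> verts H \<and> {x, y} \<in> edges H"
  shows "path_in H xs"
  using assms
proof (induction xs)
  case (Cons x xs)
  note step = Cons.prems(4)
  show ?case
  proof (cases "xs = []")
    case True
    then show ?thesis using Cons.prems(1,3) by (simp add: path_in_def)
  next
    case False
    have xs: "path_in G xs" and x: "x \<notin> set xs" and e: "{x, hd xs} \<in> edges G"
      using Cons.prems(1) False by (auto simp: path_in_def successively_Cons)
    have hd: "hd xs \<in> verts H" "{x, hd xs} \<in> edges H"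
      using step[of x "hd xs"] Cons.prems(3) False e by auto
    have "path_in H xs"
      by (rule Cons.IH[OF xs False hd(1)]) (rule step, simp_all)
    then show ?thesis
      using hd Cons.prems(3) x False by (auto simp: path_in_def successively_Cons)
  qed
next
  case Nil
  then show ?case by blast
qed

text \<open>This is how a path is located in a part of a tree: if a path cannot leave \<open>H\<close> along its own
  vertices, then one common vertex puts all of it into \<open>H\<close>.\<close>

lemma path_in_confined:
  assumes "path_in G xs" "z \<in> set xs" "z \<in> verts H"
    and step: "\<And>x y. x \<in> set xs \<Longrightarrow> y \<in> set xs \<Longrightarrow> x \<in> verts H \<Longrightarrow> {x, y} \<in> edges G \<Longrightarrow>
           y \<in> verts H \<and> {x, y} \<in> edges H"
  shows "path_in H xs"
proof -
  obtain ys zs where xs: "xs = ys @ z # zs"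
    using assms(2) by (meson split_list)
  have G: "path_in G (rev (ys @ [z]))" "path_in G (z # zs)"
    using assms(1) path_in_appendD[of G "ys @ [z]" zs] path_in_appendD[of G ys "z # zs"]
    unfolding path_in_rev xs by simp_all
  have "path_in H (rev (ys @ [z]))"
  proof (rule path_in_confined_hd[OF G(1)])
    show "y \<in> verts H \<and> {x, y} \<in> edges H"
      if "x \<in> set (rev (ys @ [z]))" "y \<in> set (rev (ys @ [z]))" "x \<in> verts H" "{x, y} \<in> edges G"
      for x y
      by (rule step) (use that xs in auto)
  qed (use assms(3) in auto)
  then have "path_in H (ys @ [z])" unfolding path_in_rev .
  moreover have "path_in H (z # zs)"
  proof (rule path_in_confined_hd[OF G(2)])
    show "y \<in> verts H \<and> {x, y} \<in> edges H"
      if "x \<in> set (z # zs)" "y \<in> set (z # zs)" "x \<in> verts H" "{x, y} \<in> edges G" for x y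
      by (rule step) (use that xs in auto)
  qed (use assms(3) in auto)
  ultimately show ?thesis
    using assms(1) unfolding xs by (auto simp: path_in_def successively_append_iff)
qed

text \<open>Saturation speaks of subgraphs isomorphic to a path, the combinatorial argument of lists. The
  isomorphism and the list determine each other: the list enumerates the vertices by their position,
  and distinctness makes the position a function of the vertex.\<close>

lemma copies_path_graph_iff:
  "copies (path_graph k) G \<noteq> {} \<longleftrightarrow> (\<exists>xs. path_in G xs \<and> length xs = k)"
proof
  assume "copies (path_graph k) G \<noteq> {}"
  then obtain S f where S: "subgraph S G"
    and bij: "bij_betw f (verts S) {..<k}"
    and f: "\<forall>u\<in>verts S. \<forall>v\<in>verts S. {u, v} \<in> edges S \<longleftrightarrow> {f u, f v} \<in> edges (path_graph k)"
    by (auto simp: copies_def isomorphic_def path_graph_def)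
  define g where "g = inv_into (verts S) f"
  have g: "bij_betw g {..<k} (verts S)" "\<And>i. i < k \<Longrightarrow> f (g i) = i"
    using bij by (auto simp: g_def bij_betw_inv_into bij_betw_inv_into_right)
  have "path_in G (map g [0..<k])"
    unfolding path_in_def
  proof (intro conjI)
    show "distinct (map g [0..<k])"
      using g(1) by (auto simp: distinct_map bij_betw_def atLeast0LessThan)
    show "set (map g [0..<k]) \<subseteq> verts G"
      using g(1) S by (auto simp: bij_betw_def subgraph_def)
    have "{g i, g (Suc i)} \<in> edges G" if "Suc i < k" for i
    proof -
      have "g i \<in> verts S" "g (Suc i) \<in> verts S"
        using g(1) that by (auto simp: bij_betw_def)
      moreover have "{f (g i), f (g (Suc i))} \<in> edges (path_graph k)"
        using g(2) that by (auto simp: path_graph_def)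
      ultimately show ?thesis using f S by (auto simp: subgraph_def)
    qed
    then show "successively (\<lambda>x y. {x, y} \<in> edges G) (map g [0..<k])"
      by (auto simp: successively_conv_nth)
  qed
  then show "\<exists>xs. path_in G xs \<and> length xs = k"
    by (intro exI[of _ "map g [0..<k]"]) simp
next
  assume "\<exists>xs. path_in G xs \<and> length xs = k"
  then obtain xs where xs: "path_in G xs" and k: "length xs = k" by blast
  define S where "S = (set xs, {{xs ! i, xs ! Suc i} |i. Suc i < k})"
  have edge: "{xs ! i, xs ! Suc i} \<in> edges G" if "Suc i < k" for i
    using xs that k by (auto simp: path_in_def successively_conv_nth)
  have dist: "distinct xs" using xs by (simp add: path_in_def)
  have "subgraph S G"
    unfolding subgraph_def simple_graph_def S_def
    using edge xs k dist by (auto simp: path_in_def nth_eq_iff_index_eq)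
  moreover have "isomorphic S (path_graph k)"
  proof -
    have b: "bij_betw ((!) xs) {..<k} (set xs)"
      using bij_betw_nth[OF dist] k by simp
    define f where "f = inv_into {..<k} ((!) xs)"
    have f: "bij_betw f (set xs) {..<k}" "\<And>i. i < k \<Longrightarrow> f (xs ! i) = i"
      using b by (auto simp: f_def bij_betw_inv_into bij_betw_inv_into_left)
    have "{u, v} \<in> edges S \<longleftrightarrow> {f u, f v} \<in> edges (path_graph k)"
      if uv: "u \<in> set xs" "v \<in> set xs" for u v
    proof -
      obtain i j where ij: "i < k" "u = xs ! i" "j < k" "v = xs ! j"
        using uv k by (metis in_set_conv_nth)
      have "{xs ! i, xs ! j} = {xs ! l, xs ! Suc l} \<longleftrightarrow> {i, j} = {l, Suc l}" if "Suc l < k" for l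
        using that ij k dist by (auto simp: doubleton_eq_iff nth_eq_iff_index_eq)
      then show ?thesis
        using ij f(2) by (auto simp: S_def path_graph_def)
    qed
    then show ?thesis
      using f(1) unfolding isomorphic_def by (auto simp: S_def path_graph_def intro!: exI[of _ f])
  qed
  ultimately show "copies (path_graph k) G \<noteq> {}"
    unfolding copies_def by blast
qed

lemma copies_path_graph_nonempty:
  assumes "path_in G xs" "k \<le> length xs"
  shows "copies (path_graph k) G \<noteq> {}"
  using assms path_in_appendD(1)[of G "take k xs" "drop k xs"]
  by (auto simp: copies_path_graph_iff intro!: exI[of _ "take k xs"])

section \<open>Triangles\<close>

definition triangle_free :: "'a graph \<Rightarrow> bool" where
  "triangle_free G \<longleftrightarrow>
     \<not> (\<exists>x y z. distinct [x, y, z] \<and> {x, y} \<in> edges G \<and> {y, z} \<in> edges G \<and> {x, z} \<in> edges G)"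

lemma copies_complete_graph_empty:
  assumes "triangle_free G" "r \<ge> 3"
  shows "copies (complete_graph r) G = {}"
proof (rule ccontr)
  assume "copies (complete_graph r) G \<noteq> {}"
  then obtain S f where S: "subgraph S G"
    and "bij_betw f (verts S) (verts (complete_graph r))"
    and f: "\<forall>u\<in>verts S. \<forall>v\<in>verts S. {u, v} \<in> edges S \<longleftrightarrow> {f u, f v} \<in> edges (complete_graph r)"
    unfolding copies_def isomorphic_def by blast
  then have bij: "bij_betw f (verts S) {..<r}"
    by (simp add: complete_graph_def)
  have surj: "\<exists>x\<in>verts S. f x = i" if "i < 3" for i
  proof -
    have "i \<in> f ` verts S" using bij that assms(2) by (auto simp: bij_betw_def)
    then show ?thesis by blast
  qed
  obtain x y z where xyz: "x \<in> verts S" "f x = 0" "y \<in> verts S" "f y = 1" "z \<in> verts S" "f z = 2"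
    using surj[of 0] surj[of 1] surj[of 2] by auto
  then have "{x, y} \<in> edges S" "{y, z} \<in> edges S" "{x, z} \<in> edges S" "distinct [x, y, z]"
    using f assms(2) by (auto simp: complete_graph_def)
  then show False
    using S assms(1) unfolding triangle_free_def subgraph_def by blast
qed

section \<open>Full trees\<close>

definition graft :: "'a \<Rightarrow> 'a set \<Rightarrow> ('a \<Rightarrow> 'a graph) \<Rightarrow> 'a graph" where
  "graft r C T = (insert r (\<Union>c\<in>C. verts (T c)), (\<Union>c\<in>C. insert {r, c} (edges (T c))))"

text \<open>Index \<open>h\<close> is the height; all leaves are at this depth. The subtrees are indexed by
  their own roots. \<open>C\<close> being neither empty nor a singleton means that there are at least two
  children; no upper bound is imposed, so that the number of vertices can be adjusted.\<close>

inductive full_tree :: "nat \<Rightarrow> 'a \<Rightarrow> 'a graph \<Rightarrow> bool" where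
  leaf: "full_tree 0 r ({r}, {})"
| node: "full_tree (Suc h) r (graft r C T)"
  if "finite C" "\<not> is_singleton C" "C \<noteq> {}"
    and "\<And>c. c \<in> C \<Longrightarrow> full_tree h c (T c)"
    and "\<And>c. c \<in> C \<Longrightarrow> r \<notin> verts (T c)"
    and "disjoint_family_on (\<lambda>c. verts (T c)) C"

lemma edge_in_verts:
  assumes "simple_graph G" "{x, y} \<in> edges G"
  shows "x \<in> verts G" "y \<in> verts G" "x \<noteq> y"
proof -
  have "{x, y} \<subseteq> verts G" "card {x, y} = 2" using assms unfolding simple_graph_def by blast+
  then show "x \<in> verts G" "y \<in> verts G" "x \<noteq> y" by auto
qed

lemma simple_graph_graft:
  assumes "finite C"
    and "\<And>c. c \<in> C \<Longrightarrow> simple_graph (T c) \<and> c \<in> verts (T c) \<and> r \<notin> verts (T c)"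
  shows "simple_graph (graft r C T)"
proof -
  have "e \<subseteq> verts (graft r C T) \<and> card e = 2" if e: "e \<in> edges (graft r C T)" for e
  proof -
    obtain c where c: "c \<in> C" "e = {r, c} \<or> e \<in> edges (T c)"
      using e by (auto simp: graft_def)
    have "card {r, c} = 2" using assms(2)[OF c(1)] by (auto simp: card_2_iff)
    then show ?thesis
      using c assms(2)[OF c(1)] by (auto simp: graft_def simple_graph_def)
  qed
  moreover have "finite (verts (graft r C T))"
    using assms by (auto simp: graft_def simple_graph_def)
  ultimately show ?thesis by (simp add: simple_graph_def)
qed

lemma simple_graph_full_tree:
  assumes "full_tree h r G"
  shows "simple_graph G" "r \<in> verts G"
proof -
  have r: "r \<in> verts G" if "full_tree h r G" for h r and G :: "'a graph"
    using that by cases (auto simp: graft_def)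
  show "simple_graph G"
    using assms
  proof induction
    case (leaf r)
    show ?case by (simp add: simple_graph_def)
  next
    case (node C h T r)
    show ?case
      by (rule simple_graph_graft) (simp_all add: node r[OF node(4)])
  qed
  show "r \<in> verts G" using r assms .
qed

lemma full_tree_descend:
  assumes "full_tree h r G"
  shows "\<exists>xs. path_in G xs \<and> xs \<noteq> [] \<and> hd xs = r \<and> length xs = Suc h"
  using assms
proof induction
  case (leaf r)
  show ?case by (rule exI[of _ "[r]"]) (simp add: path_in_def)
next
  case (node C h T r)
  then obtain c where c: "c \<in> C" by blast
  then obtain xs where xs: "path_in (T c) xs" "xs \<noteq> []" "hd xs = c" "length xs = Suc h"
    using node by blast
  then have "path_in (graft r C T) (r # xs)"
    using c node by (intro path_in_Cons[of "T c"]) (auto simp: graft_def)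
  then show ?case using xs by (intro exI[of _ "r # xs"]) simp
qed

lemma full_tree_connected:
  assumes "full_tree h r G" "v \<in> verts G"
  shows "\<exists>xs. path_in G xs \<and> xs \<noteq> [] \<and> hd xs = r \<and> last xs = v"
  using assms
proof (induction arbitrary: v)
  case (leaf r)
  then show ?case by (intro exI[of _ "[r]"]) (simp add: path_in_def)
next
  case (node C h T r)
  show ?case
  proof (cases "v = r")
    case True
    then show ?thesis by (intro exI[of _ "[r]"]) (simp add: path_in_def graft_def)
  next
    case False
    then obtain c where c: "c \<in> C" "v \<in> verts (T c)"
      using node.prems by (auto simp: graft_def)
    then obtain xs where xs: "path_in (T c) xs" "xs \<noteq> []" "hd xs = c" "last xs = v"
      using node.IH by blast
    then have "path_in (graft r C T) (r # xs)"
      using c node by (intro path_in_Cons[of "T c"]) (auto simp: graft_def)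
    then show ?thesis using xs by (intro exI[of _ "r # xs"]) simp
  qed
qed

text \<open>From a vertex below the root, go up to the root and come down again through a different child
  of the root: this descent has as many vertices as one from the root, less one for the root itself,
  and at least two more vertices, the root and the start, precede it.\<close>

lemma full_tree_long_path_from:
  assumes "full_tree h r G" "v \<in> verts G"
  shows "\<exists>xs. path_in G xs \<and> xs \<noteq> [] \<and> hd xs = v \<and> length xs \<ge> Suc h + of_bool (v \<noteq> r)"
proof (cases "v = r")
  case True
  then show ?thesis using full_tree_descend[OF assms(1)] by force
next
  case False
  from assms(1) show ?thesis
  proof cases
    case leaf
    then show ?thesis using assms False by simp
  next
    case (node C h' T)
    then obtain c where c: "c \<in> C" "v \<in> verts (T c)"
      using assms(2) False by (auto simp: graft_def)
    obtain d where d: "d \<in> C" "d \<noteq> c"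
      using node c unfolding is_singleton_def by blast
    obtain xs where xs: "path_in (T c) xs" "xs \<noteq> []" "hd xs = c" "last xs = v"
      using full_tree_connected[of h' c "T c" v] c node by blast
    obtain ys where ys: "path_in (T d) ys" "ys \<noteq> []" "hd ys = d" "length ys = Suc h'"
      using full_tree_descend[of h' d "T d"] d node by blast
    have disj: "verts (T c) \<inter> verts (T d) = {}"
      using node(6-) c d by (auto simp: disjoint_family_on_def)
    let ?K = "(insert r (verts (T d)), insert {r, d} (edges (T d)))"
    have "path_in ?K (r # ys)"
      using node d ys by (intro path_in_Cons[of "T d"]) auto
    then have "path_in G (rev xs @ r # ys)"
      using node c d xs disj
      by (intro path_in_append[of "T c" _ ?K])
         (auto simp: path_in_rev graft_def last_rev insert_commute)
    then show ?thesis
      using xs ys node False by (intro exI[of _ "rev xs @ r # ys"]) (cases xs, auto simp: hd_rev hd_append)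
  qed
qed

lemma add_edge_commute: "add_edge u v G = add_edge v u G"
  by (simp add: add_edge_def insert_commute)

text \<open>If the root is an end, jump
  along the new edge and follow a long path from its other end, which is not a child of the root.
  If the ends lie below different children, walk from the root to one end, jump, and follow
  a long path in the other subtree; compared with a descent from the root, the walk supplies the
  extra vertex. If both lie below the same
  child, this is the same question one level lower.\<close>

lemma full_tree_add_edge:
  assumes "full_tree h r G" "u \<in> verts G" "v \<in> verts G" "u \<noteq> v" "{u, v} \<notin> edges G"
  shows "\<exists>xs. path_in (add_edge u v G) xs \<and> xs \<noteq> [] \<and> hd xs = r \<and> length xs \<ge> h + 2"
  using assms
proof (induction arbitrary: u v)
  case (node C h T r)
  let ?G = "graft r C T"
  \<comment> \<open>The other end of the new edge is not the root of its subtree, so the path in that subtree has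
      one vertex more than a descent.\<close>
  have root: "\<exists>xs. path_in (add_edge r v ?G) xs \<and> xs \<noteq> [] \<and> hd xs = r \<and> length xs \<ge> Suc h + 2"
    if v: "v \<in> verts ?G" "v \<noteq> r" "{r, v} \<notin> edges ?G" for v
  proof -
    obtain c where c: "c \<in> C" "v \<in> verts (T c)" "v \<noteq> c"
      using v by (auto simp: graft_def)
    then obtain xs where xs: "path_in (T c) xs" "xs \<noteq> []" "hd xs = v" "length xs \<ge> h + 2"
      using full_tree_long_path_from[of h c "T c" v] node by auto
    then have "path_in (add_edge r v ?G) (r # xs)"
      using node c by (intro path_in_Cons[of "T c"]) (auto simp: graft_def add_edge_def)
    then show ?thesis using xs by (intro exI[of _ "r # xs"]) auto
  qed
  show ?case
  proof (cases "u = r \<or> v = r")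
    case True
    then show ?thesis
      using root[of v] root[of u] node.prems by (auto simp: add_edge_commute insert_commute)
  next
    case False
    then obtain c d where c: "c \<in> C" "u \<in> verts (T c)" and d: "d \<in> C" "v \<in> verts (T d)"
      using node.prems by (auto simp: graft_def)
    show ?thesis
    proof (cases "c = d")
      case True
      have "{u, v} \<notin> edges (T c)" using node.prems c by (auto simp: graft_def)
      then obtain xs where
        xs: "path_in (add_edge u v (T c)) xs" "xs \<noteq> []" "hd xs = c" "length xs \<ge> h + 2"
        using node.IH[OF c(1) c(2), of v] node.prems True d by auto
      then have "path_in (add_edge u v ?G) (r # xs)"
        using node c by (intro path_in_Cons[of "add_edge u v (T c)"]) (auto simp: graft_def add_edge_def)
      then show ?thesis using xs by (intro exI[of _ "r # xs"]) auto
    next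
      case False
      have disj: "verts (T c) \<inter> verts (T d) = {}"
        using node False c d by (auto simp: disjoint_family_on_def)
      obtain xs where xs: "path_in (T c) xs" "xs \<noteq> []" "hd xs = c" "last xs = u"
        using full_tree_connected[of h c "T c" u] c node by blast
      obtain ys where ys: "path_in (T d) ys" "ys \<noteq> []" "hd ys = v" "length ys \<ge> Suc h"
        using full_tree_long_path_from[of h d "T d" v] d node by fastforce
      let ?K = "(verts (T c) \<union> verts (T d), insert {u, v} (edges (T c) \<union> edges (T d)))"
      have "path_in ?K (xs @ ys)"
        using xs ys disj by (intro path_in_append[of "T c" _ "T d"]) auto
      then have "path_in (add_edge u v ?G) (r # xs @ ys)"
        using node c d xs by (intro path_in_Cons[of ?K]) (auto simp: graft_def add_edge_def)
      then show ?thesis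
        using xs ys by (intro exI[of _ "r # xs @ ys"]) (cases xs, auto)
    qed
  qed
qed simp

lemma graft_edge_cases:
  assumes "{x, y} \<in> edges (graft r C T)" "c \<in> C" "x \<in> verts (T c)" "y \<noteq> r"
    and "\<And>c. c \<in> C \<Longrightarrow> simple_graph (T c)" "\<And>c. c \<in> C \<Longrightarrow> r \<notin> verts (T c)"
    and "disjoint_family_on (\<lambda>c. verts (T c)) C"
  shows "{x, y} \<in> edges (T c)"
proof -
  have "x \<noteq> r" using assms by auto
  then obtain d where d: "d \<in> C" "{x, y} \<in> edges (T d)"
    using assms(1,4) by (auto simp: graft_def doubleton_eq_iff)
  then have "x \<in> verts (T d)" using assms(5) edge_in_verts(1) by metis
  then have "c = d" using assms(2,3,7) d by (auto simp: disjoint_family_on_def)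
  then show ?thesis using d by simp
qed

text \<open>Distinct subtrees are connected only through the root.\<close>

lemma path_in_graft_avoiding_root:
  assumes "path_in (graft r C T) xs" "x \<in> set xs" "x \<in> verts (T c)" "r \<notin> set xs" "c \<in> C"
    and "\<And>c. c \<in> C \<Longrightarrow> simple_graph (T c)" "\<And>c. c \<in> C \<Longrightarrow> r \<notin> verts (T c)"
    and "disjoint_family_on (\<lambda>c. verts (T c)) C"
  shows "path_in (T c) xs"
proof (rule path_in_confined[OF assms(1-3)])
  fix x y assume "x \<in> set xs" "y \<in> set xs" "x \<in> verts (T c)" "{x, y} \<in> edges (graft r C T)"
  then have "{x, y} \<in> edges (T c)"
    using graft_edge_cases[of x y r C T c] assms(4-) by blast
  then show "y \<in> verts (T c) \<and> {x, y} \<in> edges (T c)"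
    using edge_in_verts assms(5,6) by metis
qed

text \<open>A path that starts at the root cannot return to it, so it stays below the child it enters
  first and is again a path from a root there.\<close>

lemma full_tree_path_from_root_le:
  assumes "full_tree h r G" "path_in G (r # xs)"
  shows "length xs \<le> h"
  using assms
proof (induction arbitrary: xs)
  case (leaf r)
  then show ?case by (cases xs) (auto simp: path_in_def)
next
  case (node C h T r)
  show ?case
  proof (cases xs)
    case (Cons c ys)
    have r: "r \<notin> set xs" "c \<noteq> r" and "{r, c} \<in> edges (graft r C T)"
      using node.prems Cons by (auto simp: path_in_def)
    have simple: "simple_graph (T d)" "d \<in> verts (T d)" if "d \<in> C" for d
      using simple_graph_full_tree[OF node.hyps(4)[OF that]] by auto
    have "\<not> {r, c} \<in> edges (T d)" if "d \<in> C" for d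
      using edge_in_verts(1)[OF simple(1)] node that by blast
    then have c: "c \<in> C"
      using \<open>{r, c} \<in> _\<close> by (auto simp: graft_def doubleton_eq_iff)
    have "path_in (graft r C T) xs"
      using path_in_appendD(2)[of _ "[r]" xs] node.prems by simp
    then have "path_in (T c) xs"
      using path_in_graft_avoiding_root[of r C T xs c c] r c simple node Cons by auto
    then show ?thesis using node.IH[OF c] Cons by simp
  qed simp
qed

text \<open>Split a path at the root: both parts, read from the root, are paths from the root. A path
  that misses the root lies below one child.\<close>

lemma full_tree_path_le:
  assumes "full_tree h r G" "path_in G xs"
  shows "length xs \<le> 2 * h + 1"
  using assms
proof (induction arbitrary: xs)
  case (leaf r)
  then have "card (set xs) \<le> card {r}" by (intro card_mono) (auto simp: path_in_def)
  then show ?case using leaf by (simp add: path_in_def distinct_card)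
next
  case (node C h T r)
  have tree: "full_tree (Suc h) r (graft r C T)"
    using node by (intro full_tree.node) auto
  show ?case
  proof (cases "r \<in> set xs")
    case True
    then obtain ys zs where xs: "xs = ys @ r # zs" by (meson split_list)
    then have "path_in (graft r C T) (rev (ys @ [r]))" "path_in (graft r C T) (r # zs)"
      using node.prems path_in_appendD[of _ "ys @ [r]" zs] path_in_appendD[of _ ys "r # zs"]
      unfolding path_in_rev by auto
    then have "length (rev ys) \<le> Suc h" "length zs \<le> Suc h"
      using full_tree_path_from_root_le[OF tree] by (metis rev.simps(2) rev_rev_ident rev_swap, blast)
    then show ?thesis using xs by simp
  next
    case False
    show ?thesis
    proof (cases xs)
      case (Cons x ys)
      then obtain c where c: "c \<in> C" "x \<in> verts (T c)"
        using node.prems False by (auto simp: graft_def path_in_def)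
      have "path_in (T c) xs"
        using path_in_graft_avoiding_root[of r C T xs x c] False c node Cons
          simple_graph_full_tree(1)[OF node.hyps(4)] by auto
      then show ?thesis using node.IH[OF c(1)] by fastforce
    qed simp
  qed
qed

text \<open>A triangle through the root would contain an edge between two children of the root; any other
  triangle lies in a single subtree.\<close>

lemma full_tree_triangle_free:
  assumes "full_tree h r G"
  shows "triangle_free G"
  using assms
proof induction
  case (leaf r)
  show ?case by (simp add: triangle_free_def)
next
  case (node C h T r)
  let ?G = "graft r C T"
  have simple: "simple_graph (T d)" "d \<in> verts (T d)" if "d \<in> C" for d
    using simple_graph_full_tree[OF node.hyps(4)[OF that]] by auto
  have edge: "{x, y} \<in> edges (T c)"
    if "{x, y} \<in> edges ?G" "c \<in> C" "x \<in> verts (T c)" "y \<noteq> r" for x y c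
    using graft_edge_cases[OF that] simple node by blast
  have root: False if "{r, y} \<in> edges ?G" "{y, z} \<in> edges ?G" "{r, z} \<in> edges ?G" "distinct [r, y, z]" for y z
  proof -
    have "\<not> {r, w} \<in> edges (T d)" if "d \<in> C" for d w
      using edge_in_verts(1)[OF simple(1)] node that by blast
    then have yz: "y \<in> C" "z \<in> C"
      using that by (auto simp: graft_def doubleton_eq_iff)
    then have "{y, z} \<in> edges (T y)" using edge that simple by auto
    then have "z \<in> verts (T y)" using edge_in_verts simple yz by metis
    moreover have "verts (T y) \<inter> verts (T z) = {}"
      using node.hyps(6) yz that(4) by (simp add: disjoint_family_on_def)
    ultimately show False using simple(2)[OF yz(2)] by blast
  qed
  show ?case
    unfolding triangle_free_def
  proof clarify
    fix x y z
    assume xyz: "distinct [x, y, z]" and e: "{x, y} \<in> edges ?G" "{y, z} \<in> edges ?G" "{x, z} \<in> edges ?G"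
    then have "x \<noteq> r" "y \<noteq> r" "z \<noteq> r"
      using root[of y z] root[of x z] root[of x y] by (auto simp: insert_commute)
    moreover have "simple_graph ?G"
      using node by (intro simple_graph_full_tree(1)[OF full_tree.node]) auto
    then have "x \<in> verts ?G" using e edge_in_verts by metis
    ultimately obtain c where c: "c \<in> C" "x \<in> verts (T c)"
      by (auto simp: graft_def)
    then have "{x, y} \<in> edges (T c)" "{x, z} \<in> edges (T c)"
      using edge e \<open>y \<noteq> r\<close> \<open>z \<noteq> r\<close> by auto
    moreover from this have "{y, z} \<in> edges (T c)"
      using edge[of y z c] e c \<open>z \<noteq> r\<close> edge_in_verts(2) simple(1) by metis
    ultimately show False
      using node.IH[OF c(1)] xyz unfolding triangle_free_def by blast
  qed
qed

text \<open>The bound is the size of the complete binary tree of height \<open>h\<close>. Surplus vertices are passed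
  on to one subtree at each level, until at height 1 all of them become leaves. At height 0 there is
  no room for them.\<close>

lemma full_tree_exists:
  assumes "finite V" "card V \<ge> 2 ^ Suc h - 1" "h = 0 \<Longrightarrow> card V = 1"
  shows "\<exists>r T. full_tree h r T \<and> verts T = V"
  using assms
proof (induction h arbitrary: V)
  case 0
  then obtain r where "V = {r}" using card_1_singletonE by metis
  then show ?case by (intro exI[of _ r] exI[of _ "({r}, {})"]) (simp add: full_tree.leaf)
next
  case (Suc h)
  have "(1::nat) \<le> 2 ^ h" by simp
  then have "0 < card V" using Suc.prems(2) unfolding power_Suc by linarith
  then have "V \<noteq> {}" by auto
  then obtain r where r: "r \<in> V" by blast
  have card: "card (V - {r}) \<ge> 2 * (2 ^ Suc h - 1)"
    using Suc.prems r by (simp add: card_Diff_singleton)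
  show ?case
  proof (cases "h = 0")
    case True
    let ?T = "graft r (V - {r}) (\<lambda>c. ({c}, {}))"
    have "card (V - {r}) \<noteq> 1" "card (V - {r}) \<noteq> 0" using card True by simp_all
    moreover from this have "V - {r} \<noteq> {}" by fastforce
    ultimately have "full_tree (Suc h) r ?T"
      unfolding True using Suc.prems
      by (intro full_tree.node) (auto simp: full_tree.leaf disjoint_family_on_def is_singleton_altdef)
    moreover have "verts ?T = V" using r by (auto simp: graft_def)
    ultimately show ?thesis by blast
  next
    case False
    have "2 ^ Suc h - 1 \<le> card (V - {r})" using card by simp
    then obtain A where A: "A \<subseteq> V - {r}" "card A = 2 ^ Suc h - 1" "finite A"
      using obtain_subset_with_card_n by metis
    define B where "B = V - {r} - A"
    have B: "finite B" "card B \<ge> 2 ^ Suc h - 1"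
      using card A Suc.prems by (auto simp: B_def card_Diff_subset)
    obtain a S where S: "full_tree h a S" "verts S = A"
      using Suc.IH[of A] A False by auto
    obtain b T where T: "full_tree h b T" "verts T = B"
      using Suc.IH[of B] B False by auto
    have ab: "a \<in> A" "b \<in> B" using simple_graph_full_tree(2)[OF S(1)] simple_graph_full_tree(2)[OF T(1)] S(2) T(2) by auto
    have disj: "A \<inter> B = {}" by (auto simp: B_def)
    let ?T = "graft r {a, b} (\<lambda>c. if c = a then S else T)"
    have "a \<noteq> b" using ab disj by auto
    then have "full_tree (Suc h) r ?T"
      using S T A disj
      by (intro full_tree.node) (auto simp: disjoint_family_on_def is_singleton_def B_def)
    moreover have "verts ?T = V" using r S T A \<open>a \<noteq> b\<close> by (auto simp: graft_def B_def)
    ultimately show ?thesis by blast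
  qed
qed

section \<open>Two full trees joined at their roots\<close>

definition join :: "'a \<Rightarrow> 'a graph \<Rightarrow> 'a \<Rightarrow> 'a graph \<Rightarrow> 'a graph" where
  "join r G s H = (verts G \<union> verts H, insert {r, s} (edges G \<union> edges H))"

lemma join_commute: "join r G s H = join s H r G"
  by (auto simp: join_def)

text \<open>The two trees play symmetric roles. A locale lets every one-sided argument be
  used for the other side by interpreting it with the trees exchanged.\<close>

locale twin_tree =
  fixes a b :: nat and r s :: 'a and G H :: "'a graph"
  assumes G: "full_tree a r G" and H: "full_tree b s H"
    and disj: "verts G \<inter> verts H = {}"
begin

lemma twin_tree_swap: "twin_tree b a s r H G"
  using G H disj by unfold_locales auto

lemmas simple = simple_graph_full_tree[OF G] simple_graph_full_tree[OF H]

lemma simple_join: "simple_graph (join r G s H)"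
proof -
  have "r \<noteq> s" using simple disj by auto
  then have "card {r, s} = 2" by simp
  then show ?thesis using simple by (auto simp: simple_graph_def join_def)
qed

text \<open>The joining edge is the only one that leaves the left tree.\<close>

lemma join_edge_left:
  assumes "{x, y} \<in> edges (join r G s H)" "x \<in> verts G" "y \<noteq> s \<or> x \<noteq> r"
  shows "{x, y} \<in> edges G" "y \<in> verts G"
proof -
  have "{x, y} \<notin> edges H" using edge_in_verts(1)[OF simple(3)] assms disj by blast
  moreover have "x \<noteq> s" using assms(2) disj simple(4) by auto
  ultimately show "{x, y} \<in> edges G" using assms by (auto simp: join_def doubleton_eq_iff)
  then show "y \<in> verts G" using edge_in_verts simple by metis
qed

lemma path_in_join_left:
  assumes "path_in (join r G s H) xs" "x \<in> set xs" "x \<in> verts G" "r \<notin> set xs \<or> s \<notin> set xs"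
  shows "path_in G xs"
  using assms(1-3)
proof (rule path_in_confined)
  fix x y assume "x \<in> set xs" "y \<in> set xs" "x \<in> verts G" "{x, y} \<in> edges (join r G s H)"
  then show "y \<in> verts G \<and> {x, y} \<in> edges G"
    using join_edge_left[of x y] assms(4) by blast
qed

text \<open>A path that visits both roots, the left one first, must use the joining edge: between the roots
  it stays in the left tree, which can be left only at \<open>r\<close>. Hence it is a path that ends at \<open>r\<close>
  followed by one that starts at \<open>s\<close>.\<close>

lemma path_from_left_to_right_le:
  assumes path: "path_in (join r G s H) (ys @ r # zs)" and s: "s \<in> set zs"
  shows "length (ys @ r # zs) \<le> a + b + 2"
proof -
  interpret swap: twin_tree b a s r H G by (rule twin_tree_swap)
  obtain ps qs where zs: "zs = ps @ s # qs" using s by (meson split_list)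
  have J: "path_in (join r G s H) (ys @ r # ps)" "path_in (join r G s H) (s # qs)"
    using path path_in_appendD[of _ "ys @ r # ps" "s # qs"] unfolding zs by auto
  have dist: "distinct (ys @ r # ps @ s # qs)" using path zs by (simp add: path_in_def)
  have P: "path_in G (ys @ r # ps)"
    by (rule path_in_join_left[OF J(1), of r]) (use dist simple in auto)
  have Q: "path_in H (s # qs)"
    by (rule swap.path_in_join_left[of _ s])
       (use J(2) dist simple in \<open>auto simp: join_commute[of s H]\<close>)
  have "ps = []"
  proof (rule ccontr)
    assume ps: "ps \<noteq> []"
    have "{last (r # ps), s} \<in> edges (join r G s H)"
      using path ps unfolding zs path_in_def by (auto simp: successively_append_iff successively_Cons)
    moreover have "last ps \<in> verts G" "last ps \<noteq> r"
      using P ps dist by (auto simp: path_in_def)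
    ultimately have "s \<in> verts G" using join_edge_left[of "last ps" s] ps by auto
    then show False using disj simple by auto
  qed
  then have "path_in G (r # rev ys)"
    using P path_in_rev[of G "ys @ [r]"] by simp
  then have "length ys \<le> a" "length qs \<le> b"
    using full_tree_path_from_root_le[OF G] full_tree_path_from_root_le[OF H Q] by fastforce+
  then show ?thesis using zs \<open>ps = []\<close> by simp
qed

text \<open>A path that misses one of the roots lies in one tree, and \<open>2 * a + 1 \<le> a + b + 2\<close> as well as
  \<open>2 * b + 1 \<le> a + b + 2\<close> because the heights differ by at most one.\<close>

lemma path_in_join_le:
  assumes "path_in (join r G s H) xs" "a \<le> Suc b" "b \<le> Suc a"
  shows "length xs \<le> a + b + 2"
proof (cases "r \<in> set xs \<and> s \<in> set xs")
  case True
  then obtain ys zs where xs: "xs = ys @ r # zs" by (meson split_list)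
  have "s \<noteq> r" using disj simple by auto
  then consider "s \<in> set zs" | "s \<in> set ys" using True xs by auto
  then show ?thesis
  proof cases
    case 1
    then show ?thesis using path_from_left_to_right_le assms(1) xs by blast
  next
    case 2
    have "path_in (join r G s H) (rev zs @ r # rev ys)"
      using assms(1) path_in_rev[of _ xs] xs by simp
    then show ?thesis using path_from_left_to_right_le[of "rev zs" "rev ys"] 2 xs by simp
  qed
next
  case False
  interpret swap: twin_tree b a s r H G by (rule twin_tree_swap)
  show ?thesis
  proof (cases xs)
    case (Cons x ys)
    then have "x \<in> verts G \<or> x \<in> verts H"
      using assms(1) by (auto simp: path_in_def join_def)
    then have "path_in G xs \<or> path_in H xs"
      using path_in_join_left[OF assms(1), of x] swap.path_in_join_left[of xs x] assms(1) False Cons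
      by (auto simp: join_commute[of s H])
    then show ?thesis
      using full_tree_path_le[OF G] full_tree_path_le[OF H] assms(2,3) by fastforce
  qed simp
qed

lemma path_in_join_add_edge_left:
  assumes "u \<in> verts G" "v \<in> verts G" "u \<noteq> v" "{u, v} \<notin> edges G"
  shows "\<exists>xs. path_in (add_edge u v (join r G s H)) xs \<and> length xs \<ge> a + b + 3"
proof -
  obtain xs where xs: "path_in (add_edge u v G) xs" "xs \<noteq> []" "hd xs = r" "length xs \<ge> a + 2"
    using full_tree_add_edge[OF G assms] by blast
  obtain ys where ys: "path_in H ys" "ys \<noteq> []" "hd ys = s" "length ys = Suc b"
    using full_tree_descend[OF H] by blast
  have "path_in (add_edge u v (join r G s H)) (rev xs @ ys)"
    using xs ys disj
    by (intro path_in_append[of "add_edge u v G" _ H])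
       (auto simp: add_edge_def join_def path_in_rev last_rev)
  then show ?thesis using xs ys by (intro exI[of _ "rev xs @ ys"]) simp
qed

text \<open>The joining edge is present already, so at least one end of the new edge is not a root. The
  long path from that end supplies the extra vertex.\<close>

lemma path_in_join_add_edge_across:
  assumes "u \<in> verts G" "v \<in> verts H" "{u, v} \<notin> edges (join r G s H)"
  shows "\<exists>xs. path_in (add_edge u v (join r G s H)) xs \<and> length xs \<ge> a + b + 3"
proof -
  obtain xs where xs: "path_in G xs" "xs \<noteq> []" "hd xs = u" "length xs \<ge> Suc a + of_bool (u \<noteq> r)"
    using full_tree_long_path_from[OF G assms(1)] by blast
  obtain ys where ys: "path_in H ys" "ys \<noteq> []" "hd ys = v" "length ys \<ge> Suc b + of_bool (v \<noteq> s)"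
    using full_tree_long_path_from[OF H assms(2)] by blast
  have "path_in (add_edge u v (join r G s H)) (rev xs @ ys)"
    using xs ys disj
    by (intro path_in_append[of G _ H]) (auto simp: add_edge_def join_def path_in_rev last_rev)
  moreover have "u \<noteq> r \<or> v \<noteq> s" using assms(3) by (auto simp: join_def)
  ultimately show ?thesis using xs ys by (intro exI[of _ "rev xs @ ys"]) auto
qed

lemma path_in_join_add_edge:
  assumes "u \<in> verts (join r G s H)" "v \<in> verts (join r G s H)" "u \<noteq> v"
    and "{u, v} \<notin> edges (join r G s H)"
  shows "\<exists>xs. path_in (add_edge u v (join r G s H)) xs \<and> length xs \<ge> a + b + 3"
proof -
  interpret swap: twin_tree b a s r H G by (rule twin_tree_swap)
  have nonedge: "{u, v} \<notin> edges G" "{u, v} \<notin> edges H" using assms(4) by (auto simp: join_def)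
  consider "u \<in> verts G" "v \<in> verts G" | "u \<in> verts H" "v \<in> verts H"
    | "u \<in> verts G" "v \<in> verts H" | "u \<in> verts H" "v \<in> verts G"
    using assms(1,2) by (auto simp: join_def)
  then show ?thesis
  proof cases
    case 1
    then show ?thesis using path_in_join_add_edge_left assms nonedge by blast
  next
    case 2
    then show ?thesis using swap.path_in_join_add_edge_left[of u v] assms nonedge
      by (simp add: join_commute[of s H] add.commute)
  next
    case 3
    then show ?thesis using path_in_join_add_edge_across assms by blast
  next
    case 4
    then show ?thesis using swap.path_in_join_add_edge_across[of u v] assms
      by (simp add: join_commute[of s H] add.commute)
  qed
qed

lemma saturated_join:
  assumes "a \<le> Suc b" "b \<le> Suc a"
  shows "saturated (path_graph (a + b + 3)) (join r G s H)"
  unfolding saturated_def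
proof (intro conjI ballI impI)
  show "simple_graph (join r G s H)" by (rule simple_join)
  have "\<not> (\<exists>xs. path_in (join r G s H) xs \<and> length xs = a + b + 3)"
    using path_in_join_le assms by fastforce
  then show "copies (path_graph (a + b + 3)) (join r G s H) = {}"
    using copies_path_graph_iff by blast
  fix u v
  assume uv: "u \<in> verts (join r G s H)" "v \<in> verts (join r G s H)"
    and "u \<noteq> v \<and> {u, v} \<notin> edges (join r G s H)"
  then obtain xs where "path_in (add_edge u v (join r G s H)) xs" "length xs \<ge> a + b + 3"
    using path_in_join_add_edge by blast
  then show "copies (path_graph (a + b + 3)) (add_edge u v (join r G s H)) \<noteq> {}"
    using copies_path_graph_nonempty by blast
qed

text \<open>If two vertices of a triangle are in the left tree, so is the third: they cannot both be the
  left end of the joining edge.\<close>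

lemma no_triangle_at_left:
  assumes "x \<in> verts G" "y \<in> verts G" "z \<noteq> x" "z \<noteq> y" "x \<noteq> y"
    and "{x, y} \<in> edges (join r G s H)" "{y, z} \<in> edges (join r G s H)" "{x, z} \<in> edges (join r G s H)"
  shows False
proof -
  have "s \<notin> verts G" using disj simple by auto
  then have "{x, y} \<in> edges G" using join_edge_left[of x y] assms by blast
  moreover have "z \<in> verts G"
    using join_edge_left[of x z] join_edge_left[of y z] assms by blast
  then have "{x, z} \<in> edges G" "{y, z} \<in> edges G"
    using join_edge_left[of x z] join_edge_left[of y z] assms \<open>s \<notin> verts G\<close> by auto
  ultimately show False
    using full_tree_triangle_free[OF G] assms(3-5) unfolding triangle_free_def by force
qed

lemma triangle_free_join: "triangle_free (join r G s H)"
  unfolding triangle_free_def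
proof clarify
  interpret swap: twin_tree b a s r H G by (rule twin_tree_swap)
  let ?J = "join r G s H"
  fix x y z
  assume d: "distinct [x, y, z]" and e: "{x, y} \<in> edges ?J" "{y, z} \<in> edges ?J" "{x, z} \<in> edges ?J"
  have "x \<in> verts ?J" "y \<in> verts ?J" "z \<in> verts ?J"
    using e edge_in_verts[OF simple_join] by blast+
  then have "x \<in> verts G \<and> y \<in> verts G \<or> y \<in> verts G \<and> z \<in> verts G \<or> x \<in> verts G \<and> z \<in> verts G \<or>
      x \<in> verts H \<and> y \<in> verts H \<or> y \<in> verts H \<and> z \<in> verts H \<or> x \<in> verts H \<and> z \<in> verts H"
    by (auto simp: join_def)
  then show False
    using no_triangle_at_left[of x y z] no_triangle_at_left[of y z x] no_triangle_at_left[of x z y]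
      swap.no_triangle_at_left[of x y z] swap.no_triangle_at_left[of y z x]
      swap.no_triangle_at_left[of x z y] d e
    by (auto simp: join_commute[of s H] insert_commute)
qed

end

text \<open>The shorter tree gets the least number of vertices possible and the taller one all others.
  The condition \<open>a \<ge> 1\<close> ensures that the taller tree can take them.\<close>

lemma sat_number_complete_path_eq_0:
  assumes "a \<ge> 1" "b \<le> a" "a \<le> Suc b" "n \<ge> (2 ^ Suc a - 1) + (2 ^ Suc b - 1)" "r \<ge> 3"
  shows "sat_number (complete_graph r) n (path_graph (a + b + 3)) = 0"
proof -
  define m :: nat where "m = 2 ^ Suc b - 1"
  have "\<exists>q T. full_tree b q T \<and> verts T = {..<m}"
    by (rule full_tree_exists) (auto simp: m_def)
  then obtain q T where T: "full_tree b q T" "verts T = {..<m}" by blast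
  have "\<exists>p S. full_tree a p S \<and> verts S = {m..<n}"
    using assms by (intro full_tree_exists) (auto simp: m_def)
  then obtain p S where S: "full_tree a p S" "verts S = {m..<n}" by blast
  interpret twin_tree a b p q S T
    using S T by unfold_locales auto
  have "m \<le> n" using assms(4) unfolding m_def by linarith
  then have "verts (join p S q T) = {..<n}" using S T by (auto simp: join_def)
  moreover have "saturated (path_graph (a + b + 3)) (join p S q T)"
    using assms by (intro saturated_join) auto
  ultimately have "sat_number (complete_graph r) n (path_graph (a + b + 3))
      \<le> enat (card (copies (complete_graph r) (join p S q T)))"
    unfolding sat_number_def by (intro INF_lower) simp
  also have "\<dots> = 0"
    using copies_complete_graph_empty[OF triangle_free_join assms(5)] by (simp add: zero_enat_def)
  finally show ?thesis by simp
qed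

theorem proposition5p4:
  fixes t :: nat
  shows "(t \<ge> 3 \<and> odd t \<longrightarrow>
            (\<forall>n r :: nat. n \<ge> 3 * 2 ^ ((t + 1) div 2 - 1) - 2 \<and> r \<ge> 3 \<longrightarrow>
              sat_number (complete_graph r) n (path_graph (t + 1)) = 0)) \<and>
         (t \<ge> 4 \<and> even t \<longrightarrow>
            (\<forall>n r :: nat. n \<ge> 2 ^ (t div 2 + 1) - 2 \<and> r \<ge> 3 \<longrightarrow>
              sat_number (complete_graph r) n (path_graph (t + 1)) = 0))"
proof (intro conjI impI allI)
  fix n r :: nat
  assume t: "t \<ge> 3 \<and> odd t" and n: "n \<ge> 3 * 2 ^ ((t + 1) div 2 - 1) - 2 \<and> r \<ge> 3"
  then obtain k where k: "t = 2 * k + 1" "k \<ge> 1" by (auto elim!: oddE)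
  \<comment> \<open>The heights are \<open>b + 1\<close> and \<open>b\<close>, where \<open>t = 2 * b + 3\<close>.\<close>
  then obtain b where b: "k = Suc b" using not0_implies_Suc by (metis not_one_le_zero)
  have "(2::nat) ^ b \<ge> 1" by simp
  then have "sat_number (complete_graph r) n (path_graph (Suc b + b + 3)) = 0"
    using n k b by (intro sat_number_complete_path_eq_0) auto
  moreover have "t + 1 = Suc b + b + 3" using k b by simp
  ultimately show "sat_number (complete_graph r) n (path_graph (t + 1)) = 0" by metis
next
  fix n r :: nat
  assume t: "t \<ge> 4 \<and> even t" and n: "n \<ge> 2 ^ (t div 2 + 1) - 2 \<and> r \<ge> 3"
  then obtain k where k: "t = 2 * k" "k \<ge> 2" by (auto elim!: evenE)
  \<comment> \<open>Both heights are \<open>b\<close>, where \<open>t = 2 * b + 2\<close>.\<close>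
  then obtain b where b: "k = Suc b" "b \<ge> 1" by (cases k) auto
  have "(2::nat) ^ b \<ge> 1" by simp
  then have "sat_number (complete_graph r) n (path_graph (b + b + 3)) = 0"
    using n k b by (intro sat_number_complete_path_eq_0) auto
  moreover have "t + 1 = b + b + 3" using k b by simp
  ultimately show "sat_number (complete_graph r) n (path_graph (t + 1)) = 0" by metis
qed

end
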